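(* Let $0\le i\le g-2$ and let $M_{g-1}\supseteq\dots\supseteq M_{i+1}\supseteq M_i$ be the modules of index $\ge i$ in a flag of the type described in the context, where $M_i=\langle w,FM_{i+1},VM_{i+1}\rangle$ with $w\in M_{i+1}$. Assume that the descent condition is satisfied for all $l>i$, that is, $$F^{l-j}V^jM_l\subseteq M_l^t\quad\text{for all }0\le j\le\lfloor l/2\rfloor .$$ If $$\langle w,F^{i-j}V^jw\rangle\in W(k)\quad\text{for all }0\le j\le\lfloor i/2\rfloor,$$ then the descent condition also holds at level $i$: $$F^{i-j}V^jM_i\subseteq M_i^t\quad\text{for all }0\le j\le\lfloor i/2\rfloor .$$
   Context: $k$ is an algebraically closed field of characteristic $p$, $W(k)$ its ring of Witt vectors with Frobenius $\sigma$. A Dieudonné module is a left module over the ring $\mathcal D_k$ generated over $W(k)$ by $F,V$ with $Fw=\sigma(w)F$, $wV=V\sigma(w)$ for $w\in W(k)$, $FV=VF=p$. Here all are free of finite rank over $W(k)$; the genus is half the rank. $A_{1,1}=\mathcal D_k/\mathcal D_k(F-V)$. A quasi-polarised Dieudonné module is a Dieudonné module $M$ with a non-degenerate alternating $W(k)$-bilinear form $\langle\cdot,\cdot\rangle:M\times M\to\mathrm{Frac}(W(k))$ with $\langle Fx,y\rangle=\sigma(\langle x,Vy\rangle)$; its dual is $M^t=\{x\in M\otimes\mathrm{Frac}(W(k)):\langle x,M\rangle\subseteq W(k)\}$. Setting: $M_{g-1}\supseteq M_{g-2}\supseteq\dots$ is a descending chain of quasi-polarised supersingular Dieudonné modules of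 genus $g$ (all forms are restrictions of the one on $M_{g-1}$), as occurring in a polarised flag type quotient: $M_{g-1}\cong A_{1,1}^{\oplus g}$ with $M_{g-1}^t=F^{g-1}M_{g-1}$, and $(F,V)M_l\subseteq M_{l-1}$, $\dim_k(M_l/M_{l-1})=l$. (A full polarised flag type quotient goes down to $M_0$ and satisfies the descent condition at every level.) $\langle w,FM_{i+1},VM_{i+1}\rangle$ denotes the $W(k)$-submodule generated by $w$, $FM_{i+1}$ and $VM_{i+1}$, whereas $\langle x,y\rangle$ for two elements denotes the quasi-polarisation. *)

theory Defs
  imports "HOL-Library.Poly_Mapping" "HOL-Computational_Algebra.Computational_Algebra"
begin

section \<open>Integer polynomials in the variables indexed by pairs of naturals\<close>

type_synonym zpoly = "((nat \<times> nat) \<Rightarrow>\<^sub>0 nat) \<Rightarrow>\<^sub>0 int"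

definition zvar :: "nat \<times> nat \<Rightarrow> zpoly" where
  "zvar v = Poly_Mapping.single (Poly_Mapping.single v 1) 1"

definition mon_eval :: "(nat \<times> nat \<Rightarrow> 'a::comm_ring_1) \<Rightarrow> ((nat \<times> nat) \<Rightarrow>\<^sub>0 nat) \<Rightarrow> 'a" where
  "mon_eval f m = (\<Prod>v\<in>Poly_Mapping.keys m. f v ^ Poly_Mapping.lookup m v)"

definition zeval :: "(nat \<times> nat \<Rightarrow> 'a::comm_ring_1) \<Rightarrow> zpoly \<Rightarrow> 'a" where
  "zeval f P = (\<Sum>m\<in>Poly_Mapping.keys P. of_int (Poly_Mapping.lookup P m) * mon_eval f m)"

lemma mon_eval_superset:
  assumes "finite A" "Poly_Mapping.keys m \<subseteq> A"
  shows "mon_eval f m = (\<Prod>v\<in>A. f v ^ Poly_Mapping.lookup m v)"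
  unfolding mon_eval_def
  by (rule prod.mono_neutral_left) (use assms in \<open>auto simp: in_keys_iff\<close>)

lemma mon_eval_add: "mon_eval f (m + n) = mon_eval f m * mon_eval f n"
proof -
  let ?A = "Poly_Mapping.keys m \<union> Poly_Mapping.keys n"
  have "Poly_Mapping.keys (m + n) \<subseteq> ?A" by (rule keys_add)
  then show ?thesis
    by (simp add: mon_eval_superset[of ?A] lookup_add power_add prod.distrib)
qed

lemma zeval_add: "zeval f (P + Q) = zeval f P + zeval f Q"
  unfolding zeval_def
  by (rule setsum_keys_plus_distrib) (auto simp: algebra_simps)

lemma zeval_zero: "zeval f 0 = 0"
  by (simp add: zeval_def)

lemma zeval_sum: "zeval f (sum g A) = (\<Sum>a\<in>A. zeval f (g a))"
  by (induction A rule: infinite_finite_induct) (auto simp: zeval_add zeval_zero)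

lemma zeval_single: "zeval f (Poly_Mapping.single m c) = of_int c * mon_eval f m"
  by (cases "c = 0") (auto simp: zeval_def)

lemma poly_mapping_sum_singles:
  "P = (\<Sum>m\<in>Poly_Mapping.keys P. Poly_Mapping.single m (Poly_Mapping.lookup P m))"
proof (rule poly_mapping_eqI)
  fix k
  show "Poly_Mapping.lookup P k = Poly_Mapping.lookup (\<Sum>m\<in>Poly_Mapping.keys P. Poly_Mapping.single m (Poly_Mapping.lookup P m)) k"
  proof (cases "k \<in> Poly_Mapping.keys P")
    case True
    then have "(\<Sum>m\<in>Poly_Mapping.keys P. Poly_Mapping.lookup P m when m = k) = Poly_Mapping.lookup P k"
      by (simp add: when_def sum.delta)
    then show ?thesis by (simp add: lookup_sum lookup_single)
  next
    case False
    then have "(\<Sum>m\<in>Poly_Mapping.keys P. Poly_Mapping.lookup P m when m = k) = 0"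
      by (intro sum.neutral) (auto simp: when_def)
    with False show ?thesis by (simp add: lookup_sum lookup_single in_keys_iff)
  qed
qed

lemma zeval_mult: "zeval f (P * Q) = zeval f P * zeval f Q"
proof -
  have "P * Q = (\<Sum>m\<in>Poly_Mapping.keys P. \<Sum>n\<in>Poly_Mapping.keys Q.
      Poly_Mapping.single (m + n) (Poly_Mapping.lookup P m * Poly_Mapping.lookup Q n))"
    by (subst poly_mapping_sum_singles[of P], subst poly_mapping_sum_singles[of Q])
       (simp add: sum_product mult_single)
  also have "zeval f \<dots> = (\<Sum>m\<in>Poly_Mapping.keys P. \<Sum>n\<in>Poly_Mapping.keys Q.
      (of_int (Poly_Mapping.lookup P m) * mon_eval f m) * (of_int (Poly_Mapping.lookup Q n) * mon_eval f n))"
    by (simp add: zeval_sum zeval_single mon_eval_add algebra_simps)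
  also have "\<dots> = zeval f P * zeval f Q"
    by (simp add: zeval_def sum_product)
  finally show ?thesis .
qed

lemma zeval_one: "zeval f 1 = 1"
  by (simp add: zeval_single mon_eval_def flip: single_one)

lemma zeval_zvar: "zeval f (zvar v) = f v"
  by (simp add: zvar_def zeval_single mon_eval_def)

definition is_ring_hom :: "('a::comm_ring_1 \<Rightarrow> 'b::comm_ring_1) \<Rightarrow> bool" where
  "is_ring_hom r \<longleftrightarrow> r 1 = 1 \<and> (\<forall>a b. r (a + b) = r a + r b) \<and> (\<forall>a b. r (a * b) = r a * r b)"

context
  fixes r :: "'a::comm_ring_1 \<Rightarrow> 'b::comm_ring_1"
  assumes r: "is_ring_hom r"
begin

lemma hom_one: "r 1 = 1" and hom_add: "r (a + b) = r a + r b" and hom_mult: "r (a * b) = r a * r b"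
  using r by (auto simp: is_ring_hom_def)

lemma hom_zero: "r 0 = 0"
  using hom_add[of 0 0] by simp

lemma hom_minus: "r (- a) = - r a"
  using hom_add[of a "- a"] by (simp add: hom_zero eq_neg_iff_add_eq_0 add.commute)

lemma hom_diff: "r (a - b) = r a - r b"
  using hom_add[of a "- b"] by (simp add: hom_minus)

lemma hom_power: "r (a ^ n) = r a ^ n"
  by (induction n) (auto simp: hom_one hom_mult)

lemma hom_sum: "r (sum g A) = (\<Sum>x\<in>A. r (g x))"
  by (induction A rule: infinite_finite_induct) (auto simp: hom_zero hom_add)

lemma hom_prod: "r (prod g A) = (\<Prod>x\<in>A. r (g x))"
  by (induction A rule: infinite_finite_induct) (auto simp: hom_one hom_mult)

lemma hom_of_nat: "r (of_nat n) = of_nat n"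
  by (induction n) (auto simp: hom_zero hom_add hom_one)

lemma hom_of_int: "r (of_int n) = of_int n"
  by (cases n rule: int_cases2) (auto simp: hom_of_nat hom_minus)

lemma hom_zeval: "r (zeval f P) = zeval (\<lambda>v. r (f v)) P"
  by (simp add: zeval_def mon_eval_def hom_sum hom_mult hom_prod hom_of_int hom_power)

end

lemma is_ring_hom_zeval: "is_ring_hom (zeval f)"
  by (simp add: is_ring_hom_def zeval_one zeval_add zeval_mult)

lemma zeval_zvar_id: "zeval zvar P = P"
proof -
  have zp: "zvar v ^ k = Poly_Mapping.single (Poly_Mapping.single v k) 1" for v k
    by (induction k) (auto simp: zvar_def mult_single simp flip: single_add)
  have pr: "(\<Prod>v\<in>A. Poly_Mapping.single (g v) (1::int)) = Poly_Mapping.single (sum g A) 1"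
    for A and g :: "nat \<times> nat \<Rightarrow> (nat \<times> nat) \<Rightarrow>\<^sub>0 nat"
    by (induction A rule: infinite_finite_induct) (auto simp: mult_single)
  have m: "mon_eval zvar m = Poly_Mapping.single m 1" for m
    by (simp add: mon_eval_def zp pr flip: poly_mapping_sum_singles)
  have "zeval zvar P = (\<Sum>m\<in>Poly_Mapping.keys P. Poly_Mapping.single m (Poly_Mapping.lookup P m))"
    by (simp add: zeval_def m mult_single flip: single_of_int)
  then show ?thesis by (simp flip: poly_mapping_sum_singles)
qed

lemma lookup_of_int_mult: "Poly_Mapping.lookup (of_int c * P) m = c * Poly_Mapping.lookup (P::zpoly) m"
proof (induction c rule: int_induct[where k = 0])
  case base then show ?case by simp
next
  case (step1 i) then show ?case by (simp add: algebra_simps lookup_add)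
next
  case (step2 i) then show ?case by (simp add: algebra_simps lookup_minus)
qed

lemma zpoly_cancel:
  assumes "(of_int c :: zpoly) * P = of_int c * Q" "c \<noteq> 0"
  shows "P = Q"
  by (rule poly_mapping_eqI) (metis assms lookup_of_int_mult mult_left_cancel)

definition zpoly_div :: "zpoly \<Rightarrow> int \<Rightarrow> zpoly" where
  "zpoly_div P c = Poly_Mapping.map (\<lambda>a. a div c) P"

lemma zpoly_div_mult: "c \<noteq> 0 \<Longrightarrow> zpoly_div (of_int c * P) c = P"
  by (rule poly_mapping_eqI)
     (simp add: zpoly_div_def Poly_Mapping.map.rep_eq lookup_of_int_mult when_def)

section \<open>Witt polynomials\<close>

text \<open>\<open>ghost p x n\<close> is the n-th Witt polynomial (ghost component) of x. \<open>unghost p g\<close> solves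
  \<open>ghost p u = g\<close> recursively for u. The coefficientwise integer division by \<open>p ^ n\<close> is exact when
  g satisfies Dwork's congruences (see \<open>ghost_unghost\<close>), which holds for all uses below.\<close>

definition ghost :: "nat \<Rightarrow> (nat \<Rightarrow> 'a::comm_ring_1) \<Rightarrow> nat \<Rightarrow> 'a" where
  "ghost p x n = (\<Sum>i\<le>n. of_nat p ^ i * x i ^ (p ^ (n - i)))"

fun unghost :: "nat \<Rightarrow> (nat \<Rightarrow> zpoly) \<Rightarrow> nat \<Rightarrow> zpoly" where
  "unghost p g n =
     zpoly_div (g n - (\<Sum>i<n. of_nat p ^ i * unghost p g i ^ (p ^ (n - i)))) (int p ^ n)"

declare unghost.simps [simp del]


lemma dvd_power_p_diff:
  fixes a b :: "'a::comm_ring_1"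
  assumes "of_nat p ^ Suc k dvd a - b"
  shows "of_nat p ^ Suc (Suc k) dvd a ^ p - b ^ p"
proof -
  have p: "of_nat p dvd a - b"
    using assms by (auto intro: dvd_mult_left)
  have "of_nat p dvd (\<Sum>i<p. b ^ (p - Suc i) * a ^ i) - (\<Sum>i<p. b ^ (p - Suc i) * b ^ i)"
    unfolding sum_subtractf[symmetric]
  proof (rule dvd_sum)
    fix i
    have "a - b dvd a ^ i - b ^ i"
      by (metis dvd_triv_left power_diff_sumr2)
    then show "of_nat p dvd b ^ (p - Suc i) * a ^ i - b ^ (p - Suc i) * b ^ i"
      using p by (metis dvd_mult dvd_trans right_diff_distrib)
  qed
  moreover have "(\<Sum>i<p. b ^ (p - Suc i) * b ^ i) = of_nat p * b ^ (p - 1)"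
    by (simp flip: power_add)
  ultimately have "of_nat p dvd (\<Sum>i<p. b ^ (p - Suc i) * a ^ i)"
    using dvd_add[of "of_nat p" "(\<Sum>i<p. b ^ (p - Suc i) * a ^ i) - of_nat p * b ^ (p - 1)" "of_nat p * b ^ (p - 1)"]
    by simp
  then have "of_nat p ^ Suc k * of_nat p dvd (a - b) * (\<Sum>i<p. b ^ (p - Suc i) * a ^ i)"
    using assms by (intro mult_dvd_mono)
  moreover have "of_nat p ^ Suc k * of_nat p = (of_nat p ^ Suc (Suc k) :: 'a)"
    by (simp add: mult.commute)
  ultimately show ?thesis
    by (simp only: power_diff_sumr2)
qed

lemma dvd_power_p_power_diff:
  fixes a b :: "'a::comm_ring_1"
  assumes "of_nat p dvd a - b"
  shows "of_nat p ^ Suc k dvd a ^ (p ^ k) - b ^ (p ^ k)"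
proof (induction k)
  case 0 then show ?case using assms by simp
next
  case (Suc k)
  have "p ^ Suc k = p ^ k * p" by simp
  with dvd_power_p_diff[OF Suc] show ?case by (simp only: power_mult)
qed

lemma prime_dvd_binomial_expansion:
  fixes a b :: "'a::comm_ring_1"
  assumes "prime p"
  shows "of_nat p dvd (a + b) ^ p - (a ^ p + b ^ p)"
proof -
  have p0: "0 < p" using assms by (simp add: prime_gt_0_nat)
  let ?t = "\<lambda>k. of_nat (p choose k) * a ^ k * b ^ (p - k)"
  have "{..p} = {0<..<p} \<union> {0, p}" using p0 by auto
  then have "(a + b) ^ p = (\<Sum>k\<in>{0<..<p} \<union> {0, p}. ?t k)"
    by (simp only: binomial_ring)
  also have "\<dots> = (\<Sum>k\<in>{0<..<p}. ?t k) + (\<Sum>k\<in>{0, p}. ?t k)"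
    by (rule sum.union_disjoint) auto
  finally have "(a + b) ^ p = (\<Sum>k\<in>{0<..<p}. ?t k) + (\<Sum>k\<in>{0, p}. ?t k)" .
  moreover have "(\<Sum>k\<in>{0, p}. ?t k) = a ^ p + b ^ p" using p0 by simp
  moreover have "of_nat p dvd (\<Sum>k\<in>{0<..<p}. ?t k)"
  proof (rule dvd_sum)
    fix k assume "k \<in> {0<..<p}"
    then have "p dvd p choose k" using assms by (intro dvd_choose_prime) auto
    then have "(of_nat p :: 'a) dvd of_nat (p choose k)" by (metis dvd_def of_nat_mult)
    then show "of_nat p dvd ?t k" by (simp add: dvd_mult2)
  qed
  ultimately show ?thesis by simp
qed

text \<open>The lift of Frobenius on the polynomial ring.\<close>

definition zfrob :: "nat \<Rightarrow> zpoly \<Rightarrow> zpoly" where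
  "zfrob p = zeval (\<lambda>v. zvar v ^ p)"

lemma is_ring_hom_zfrob: "is_ring_hom (zfrob p)"
  by (simp add: zfrob_def is_ring_hom_zeval)

lemma zpoly_induct [case_names one diff mult var]:
  assumes one: "S 1" and diff: "\<And>P Q. S P \<Longrightarrow> S Q \<Longrightarrow> S (P - Q)"
    and mult: "\<And>P Q. S P \<Longrightarrow> S Q \<Longrightarrow> S (P * Q)" and var: "\<And>v. S (zvar v)"
  shows "S P"
proof -
  have zero: "S 0" using diff[OF one one] by simp
  have add: "S (P + Q)" if "S P" "S Q" for P Q
    using diff[OF that(1) diff[OF zero that(2)]] by simp
  have int: "S (of_int c)" for c
    by (induction c rule: int_induct[where k = 0]) (auto intro: zero one add diff)
  have pow: "S (P ^ n)" if "S P" for P n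
    by (induction n) (auto intro: one mult that)
  have prod: "S (prod f A)" if "\<And>a. S (f a)" for f :: "nat \<times> nat \<Rightarrow> zpoly" and A
    by (induction A rule: infinite_finite_induct) (auto intro: one mult that)
  have sum: "S (sum f A)" if "\<And>a. S (f a)" for f :: "(nat \<times> nat \<Rightarrow>\<^sub>0 nat) \<Rightarrow> zpoly" and A
    by (induction A rule: infinite_finite_induct) (auto intro: zero add that)
  have "S (zeval zvar P)"
    unfolding zeval_def mon_eval_def by (intro sum mult int prod pow var)
  then show ?thesis by (simp add: zeval_zvar_id)
qed

lemma zfrob_cong_power:
  assumes "prime p"
  shows "of_nat p dvd zfrob p P - P ^ p"
proof (induction P rule: zpoly_induct)
  case one
  show ?case by (simp add: hom_one[OF is_ring_hom_zfrob])
next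
  case (diff P Q)
  have "of_nat p dvd ((P - Q) + Q) ^ p - ((P - Q) ^ p + Q ^ p)"
    by (rule prime_dvd_binomial_expansion[OF assms])
  moreover have "of_nat p dvd (zfrob p P - P ^ p) - (zfrob p Q - Q ^ p)"
    using diff by (rule dvd_diff)
  ultimately have "of_nat p dvd (((P - Q) + Q) ^ p - ((P - Q) ^ p + Q ^ p))
      + ((zfrob p P - P ^ p) - (zfrob p Q - Q ^ p))"
    by (rule dvd_add)
  moreover have "(((P - Q) + Q) ^ p - ((P - Q) ^ p + Q ^ p))
      + ((zfrob p P - P ^ p) - (zfrob p Q - Q ^ p)) = zfrob p (P - Q) - (P - Q) ^ p"
    by (simp add: hom_diff[OF is_ring_hom_zfrob])
  ultimately show ?case by simp
next
  case (mult P Q)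
  have "zfrob p (P * Q) - (P * Q) ^ p
      = zfrob p P * (zfrob p Q - Q ^ p) + (zfrob p P - P ^ p) * Q ^ p"
    by (simp add: hom_mult[OF is_ring_hom_zfrob] algebra_simps power_mult_distrib)
  then show ?case using mult by (metis dvd_add dvd_mult dvd_mult2)
next
  case (var v)
  show ?case by (simp add: zfrob_def zeval_zvar)
qed

definition dwork :: "nat \<Rightarrow> (nat \<Rightarrow> zpoly) \<Rightarrow> bool" where
  "dwork p g \<longleftrightarrow> (\<forall>n. of_nat p ^ Suc n dvd g (Suc n) - zfrob p (g n))"

lemma ghost_split: "ghost p x n = (\<Sum>i<n. of_nat p ^ i * x i ^ (p ^ (n - i))) + of_nat p ^ n * x n"
  by (simp add: ghost_def lessThan_Suc_atMost[symmetric])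

lemma ghost_unghost:
  assumes p: "prime p" and g: "dwork p g"
  shows "ghost p (unghost p g) n = g n"
proof (induction n rule: less_induct)
  case (less n)
  let ?u = "unghost p g"
  let ?s = "\<Sum>i<n. of_nat p ^ i * ?u i ^ (p ^ (n - i))"
  have "of_nat p ^ n dvd g n - ?s"
  proof (cases n)
    case 0 then show ?thesis by simp
  next
    case (Suc m)
    have "zfrob p (g m) = (\<Sum>i\<le>m. of_nat p ^ i * zfrob p (?u i) ^ (p ^ (m - i)))"
    proof -
      have "g m = (\<Sum>i\<le>m. of_nat p ^ i * ?u i ^ (p ^ (m - i)))"
        using less[of m] Suc by (simp add: ghost_def)
      then show ?thesis
        by (simp add: hom_sum[OF is_ring_hom_zfrob] hom_mult[OF is_ring_hom_zfrob]
          hom_power[OF is_ring_hom_zfrob] hom_of_nat[OF is_ring_hom_zfrob])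
    qed
    moreover have "of_nat p ^ n dvd (\<Sum>i\<le>m. of_nat p ^ i * zfrob p (?u i) ^ (p ^ (m - i)))
         - (\<Sum>i\<le>m. of_nat p ^ i * ?u i ^ (p ^ (n - i)))"
      unfolding sum_subtractf[symmetric]
    proof (rule dvd_sum)
      fix i assume i: "i \<in> {..m}"
      have "of_nat p ^ Suc (m - i) dvd zfrob p (?u i) ^ (p ^ (m - i)) - (?u i ^ p) ^ (p ^ (m - i))"
        by (rule dvd_power_p_power_diff[OF zfrob_cong_power[OF p]])
      then have "of_nat p ^ i * of_nat p ^ Suc (m - i) dvd
          of_nat p ^ i * (zfrob p (?u i) ^ (p ^ (m - i)) - (?u i ^ p) ^ (p ^ (m - i)))"
        by (rule mult_dvd_mono[OF dvd_refl])
      moreover have "(of_nat p :: zpoly) ^ i * of_nat p ^ Suc (m - i) = of_nat p ^ n"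
        using i Suc by (simp flip: power_add power_Suc)
      moreover have "(?u i ^ p) ^ (p ^ (m - i)) = ?u i ^ (p ^ (n - i))"
        using i Suc by (simp add: Suc_diff_le flip: power_mult)
      ultimately show "of_nat p ^ n dvd of_nat p ^ i * zfrob p (?u i) ^ (p ^ (m - i))
          - of_nat p ^ i * ?u i ^ (p ^ (n - i))"
        by (simp add: right_diff_distrib)
    qed
    moreover have "{..<n} = {..m}" using Suc by auto
    ultimately have "of_nat p ^ n dvd zfrob p (g m) - ?s"
      by simp
    moreover have "of_nat p ^ n dvd g n - zfrob p (g m)"
      using g Suc unfolding dwork_def by blast
    ultimately have "of_nat p ^ n dvd (g n - zfrob p (g m)) + (zfrob p (g m) - ?s)"
      by (intro dvd_add)
    then show ?thesis by simp
  qed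
  then obtain Q where Q: "g n - ?s = of_nat p ^ n * Q" by (auto elim: dvdE)
  have "?u n = Q"
    using p prime_gt_0_nat[OF p]
    by (subst unghost.simps) (use Q zpoly_div_mult[of "int p ^ n" Q] in simp)
  then show ?case using Q by (simp add: ghost_split algebra_simps)
qed

lemma ghost_hom: "is_ring_hom r \<Longrightarrow> r (ghost p x n) = ghost p (\<lambda>i. r (x i)) n"
  by (simp add: ghost_def hom_sum hom_mult hom_power hom_of_nat)

lemma ghost_Suc: "ghost p x (Suc n) = ghost p (\<lambda>i. x i ^ p) n + of_nat p ^ Suc n * x (Suc n)"
proof -
  have "(\<Sum>i<Suc n. of_nat p ^ i * x i ^ (p ^ (Suc n - i))) = ghost p (\<lambda>i. x i ^ p) n"
    unfolding ghost_def lessThan_Suc_atMost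
    by (intro sum.cong) (auto simp: Suc_diff_le simp flip: power_mult)
  then show ?thesis by (simp add: ghost_split)
qed

lemma dwork_ghost_zvar: "dwork p (ghost p (\<lambda>i. zvar (a, i)))"
proof -
  have "zfrob p (ghost p (\<lambda>i. zvar (a, i)) n) = ghost p (\<lambda>i. zvar (a, i) ^ p) n" for n
    by (simp add: ghost_hom[OF is_ring_hom_zeval] zfrob_def zeval_zvar)
  then show ?thesis by (simp add: dwork_def ghost_Suc)
qed

lemma dwork_diff: "dwork p g \<Longrightarrow> dwork p h \<Longrightarrow> dwork p (\<lambda>n. g n - h n)"
  unfolding dwork_def
proof
  fix n
  assume a: "\<forall>n. of_nat p ^ Suc n dvd g (Suc n) - zfrob p (g n)"
    "\<forall>n. of_nat p ^ Suc n dvd h (Suc n) - zfrob p (h n)"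
  have "g (Suc n) - h (Suc n) - zfrob p (g n - h n)
      = (g (Suc n) - zfrob p (g n)) - (h (Suc n) - zfrob p (h n))"
    by (simp add: hom_diff[OF is_ring_hom_zfrob])
  then show "of_nat p ^ Suc n dvd g (Suc n) - h (Suc n) - zfrob p (g n - h n)"
    using a by (metis dvd_diff)
qed

lemma dwork_zero: "dwork p (\<lambda>n. 0)"
  by (simp add: dwork_def hom_zero[OF is_ring_hom_zfrob])

lemma dwork_uminus: "dwork p g \<Longrightarrow> dwork p (\<lambda>n. - g n)"
  using dwork_diff[OF dwork_zero, of p g] by simp

lemma dwork_add: "dwork p g \<Longrightarrow> dwork p h \<Longrightarrow> dwork p (\<lambda>n. g n + h n)"
  using dwork_diff[of p g "\<lambda>n. - h n"] dwork_uminus[of p h] by simp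

lemma dwork_mult: "dwork p g \<Longrightarrow> dwork p h \<Longrightarrow> dwork p (\<lambda>n. g n * h n)"
  unfolding dwork_def
proof
  fix n
  assume a: "\<forall>n. of_nat p ^ Suc n dvd g (Suc n) - zfrob p (g n)"
    "\<forall>n. of_nat p ^ Suc n dvd h (Suc n) - zfrob p (h n)"
  have "g (Suc n) * h (Suc n) - zfrob p (g n * h n)
      = g (Suc n) * (h (Suc n) - zfrob p (h n)) + (g (Suc n) - zfrob p (g n)) * zfrob p (h n)"
    by (simp add: hom_mult[OF is_ring_hom_zfrob] algebra_simps)
  then show "of_nat p ^ Suc n dvd g (Suc n) * h (Suc n) - zfrob p (g n * h n)"
    using a by (metis dvd_add dvd_mult dvd_mult2)
qed

section \<open>Witt vector operations\<close>

text \<open>The universal polynomials for sum, product and negative, in the coordinates (0, i) of the first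
  and (1, i) of the second Witt vector.\<close>

definition witt_sum_poly :: "nat \<Rightarrow> nat \<Rightarrow> zpoly" where
  "witt_sum_poly p = unghost p (\<lambda>n. ghost p (\<lambda>i. zvar (0, i)) n + ghost p (\<lambda>i. zvar (1, i)) n)"

definition witt_prod_poly :: "nat \<Rightarrow> nat \<Rightarrow> zpoly" where
  "witt_prod_poly p = unghost p (\<lambda>n. ghost p (\<lambda>i. zvar (0, i)) n * ghost p (\<lambda>i. zvar (1, i)) n)"

definition witt_neg_poly :: "nat \<Rightarrow> nat \<Rightarrow> zpoly" where
  "witt_neg_poly p = unghost p (\<lambda>n. - ghost p (\<lambda>i. zvar (0, i)) n)"

definition val2 :: "(nat \<Rightarrow> 'a) \<Rightarrow> (nat \<Rightarrow> 'a) \<Rightarrow> nat \<times> nat \<Rightarrow> 'a" where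
  "val2 x y = (\<lambda>(a, i). if a = 0 then x i else y i)"

definition witt_add :: "nat \<Rightarrow> (nat \<Rightarrow> 'a::comm_ring_1) \<Rightarrow> (nat \<Rightarrow> 'a) \<Rightarrow> nat \<Rightarrow> 'a" where
  "witt_add p x y n = zeval (val2 x y) (witt_sum_poly p n)"

definition witt_mult :: "nat \<Rightarrow> (nat \<Rightarrow> 'a::comm_ring_1) \<Rightarrow> (nat \<Rightarrow> 'a) \<Rightarrow> nat \<Rightarrow> 'a" where
  "witt_mult p x y n = zeval (val2 x y) (witt_prod_poly p n)"

definition witt_neg :: "nat \<Rightarrow> (nat \<Rightarrow> 'a::comm_ring_1) \<Rightarrow> nat \<Rightarrow> 'a" where
  "witt_neg p x n = zeval (val2 x x) (witt_neg_poly p n)"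

definition witt_zero :: "nat \<Rightarrow> 'a::comm_ring_1" where
  "witt_zero n = 0"

definition witt_one :: "nat \<Rightarrow> 'a::comm_ring_1" where
  "witt_one n = (if n = 0 then 1 else 0)"

context
  fixes p :: nat
  assumes p: "prime p"
begin

lemma ghost_witt_add: "ghost p (witt_add p x y) n = ghost p x n + ghost p y n"
proof -
  have "ghost p (witt_add p x y) n = zeval (val2 x y) (ghost p (witt_sum_poly p) n)"
    by (simp add: ghost_hom[OF is_ring_hom_zeval] witt_add_def[abs_def])
  also have "ghost p (witt_sum_poly p) n = ghost p (\<lambda>i. zvar (0, i)) n + ghost p (\<lambda>i. zvar (1, i)) n"
    unfolding witt_sum_poly_def by (intro ghost_unghost p dwork_add dwork_ghost_zvar)
  finally show ?thesis
    by (simp add: zeval_add ghost_hom[OF is_ring_hom_zeval] zeval_zvar val2_def)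
qed

lemma ghost_witt_mult: "ghost p (witt_mult p x y) n = ghost p x n * ghost p y n"
proof -
  have "ghost p (witt_mult p x y) n = zeval (val2 x y) (ghost p (witt_prod_poly p) n)"
    by (simp add: ghost_hom[OF is_ring_hom_zeval] witt_mult_def[abs_def])
  also have "ghost p (witt_prod_poly p) n = ghost p (\<lambda>i. zvar (0, i)) n * ghost p (\<lambda>i. zvar (1, i)) n"
    unfolding witt_prod_poly_def by (intro ghost_unghost p dwork_mult dwork_ghost_zvar)
  finally show ?thesis
    by (simp add: zeval_mult ghost_hom[OF is_ring_hom_zeval] zeval_zvar val2_def)
qed

lemma ghost_witt_neg: "ghost p (witt_neg p x) n = - ghost p x n"
proof -
  have "ghost p (witt_neg p x) n = zeval (val2 x x) (ghost p (witt_neg_poly p) n)"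
    by (simp add: ghost_hom[OF is_ring_hom_zeval] witt_neg_def[abs_def])
  also have "ghost p (witt_neg_poly p) n = - ghost p (\<lambda>i. zvar (0, i)) n"
    unfolding witt_neg_poly_def by (intro ghost_unghost p dwork_uminus dwork_ghost_zvar)
  finally show ?thesis
    by (simp add: hom_minus[OF is_ring_hom_zeval] ghost_hom[OF is_ring_hom_zeval] zeval_zvar val2_def)
qed

lemma ghost_witt_zero: "ghost p witt_zero n = 0"
  using prime_gt_0_nat[OF p] by (simp add: ghost_def witt_zero_def zero_power)

lemma ghost_witt_one: "ghost p witt_one n = 1"
proof -
  have "ghost p witt_one n = (\<Sum>i\<le>n. if i = 0 then 1 else 0 :: 'a)"
    unfolding ghost_def witt_one_def
    using prime_gt_0_nat[OF p] by (intro sum.cong) (auto simp: zero_power)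
  then show ?thesis by simp
qed

lemma ghost_eqD:
  fixes x y :: "nat \<Rightarrow> zpoly"
  assumes "\<And>n. ghost p x n = ghost p y n"
  shows "x = y"
proof
  fix n show "x n = y n"
  proof (induction n rule: less_induct)
    case (less n)
    then have "(\<Sum>i<n. of_nat p ^ i * x i ^ (p ^ (n - i))) = (\<Sum>i<n. of_nat p ^ i * y i ^ (p ^ (n - i)))"
      by simp
    with assms[of n] have "of_int (int p ^ n) * x n = of_int (int p ^ n) * y n"
      by (simp add: ghost_split)
    then show ?case
      by (rule zpoly_cancel) (use prime_gt_0_nat[OF p] in simp)
  qed
qed

end

lemma witt_add_hom: "is_ring_hom r \<Longrightarrow> (\<lambda>n. r (witt_add p x y n)) = witt_add p (\<lambda>n. r (x n)) (\<lambda>n. r (y n))"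
  by (auto simp: witt_add_def hom_zeval val2_def intro!: ext arg_cong2[where f = zeval])

lemma witt_mult_hom: "is_ring_hom r \<Longrightarrow> (\<lambda>n. r (witt_mult p x y n)) = witt_mult p (\<lambda>n. r (x n)) (\<lambda>n. r (y n))"
  by (auto simp: witt_mult_def hom_zeval val2_def intro!: ext arg_cong2[where f = zeval])

lemma witt_neg_hom: "is_ring_hom r \<Longrightarrow> (\<lambda>n. r (witt_neg p x n)) = witt_neg p (\<lambda>n. r (x n))"
  by (auto simp: witt_neg_def hom_zeval val2_def intro!: ext arg_cong2[where f = zeval])

lemma witt_zero_hom: "is_ring_hom r \<Longrightarrow> (\<lambda>n. r (witt_zero n)) = witt_zero"
  by (auto simp: witt_zero_def hom_zero)

lemma witt_one_hom: "is_ring_hom r \<Longrightarrow> (\<lambda>n. r (witt_one n)) = witt_one"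
  by (auto simp: witt_one_def hom_zero hom_one)

lemmas witt_homs = witt_add_hom witt_mult_hom witt_neg_hom witt_zero_hom witt_one_hom

definition val3 :: "(nat \<Rightarrow> 'a) \<Rightarrow> (nat \<Rightarrow> 'a) \<Rightarrow> (nat \<Rightarrow> 'a) \<Rightarrow> nat \<times> nat \<Rightarrow> 'a" where
  "val3 x y z = (\<lambda>(a, i). if a = 0 then x i else if a = 1 then y i else z i)"

lemma zeval_val3:
  "(\<lambda>i. zeval (val3 x y z) (zvar (0, i))) = x"
  "(\<lambda>i. zeval (val3 x y z) (zvar (Suc 0, i))) = y"
  "(\<lambda>i. zeval (val3 x y z) (zvar (2, i))) = z"
  by (auto simp: zeval_zvar val3_def)

text \<open>Identities between Witt vectors may be checked on ghost components over the polynomial ring.\<close>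

lemma witt_transfer:
  fixes L R :: "(nat \<Rightarrow> zpoly) \<Rightarrow> (nat \<Rightarrow> zpoly) \<Rightarrow> (nat \<Rightarrow> zpoly) \<Rightarrow> nat \<Rightarrow> zpoly"
  assumes p: "prime p"
    and "\<And>x y z n. ghost p (L x y z) n = ghost p (R x y z) n"
    and L: "(\<lambda>n. zeval (val3 x y z) (L (\<lambda>i. zvar (0, i)) (\<lambda>i. zvar (Suc 0, i)) (\<lambda>i. zvar (2, i)) n)) = l"
    and R: "(\<lambda>n. zeval (val3 x y z) (R (\<lambda>i. zvar (0, i)) (\<lambda>i. zvar (Suc 0, i)) (\<lambda>i. zvar (2, i)) n)) = r"
  shows "l = r"
proof -
  have "L (\<lambda>i. zvar (0, i)) (\<lambda>i. zvar (Suc 0, i)) (\<lambda>i. zvar (2, i))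
      = R (\<lambda>i. zvar (0, i)) (\<lambda>i. zvar (Suc 0, i)) (\<lambda>i. zvar (2, i))"
    using ghost_eqD[OF p assms(2)] .
  with L R show ?thesis by simp
qed

context
  fixes p :: nat
  assumes p: "prime p"
begin

lemmas witt_ghosts = ghost_witt_add[OF p] ghost_witt_mult[OF p] ghost_witt_neg[OF p]
  ghost_witt_zero[OF p] ghost_witt_one[OF p]

lemmas witt_simps = witt_homs[OF is_ring_hom_zeval] zeval_val3

lemma witt_add_assoc: "witt_add p (witt_add p x y) z = witt_add p x (witt_add p y z)"
  by (rule witt_transfer[OF p, where x = x and y = y and z = z and
        L = "\<lambda>x y z. witt_add p (witt_add p x y) z" and R = "\<lambda>x y z. witt_add p x (witt_add p y z)"])
     (simp_all add: witt_ghosts witt_simps add.assoc)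

lemma witt_add_commute: "witt_add p x y = witt_add p y x"
  by (rule witt_transfer[OF p, where x = x and y = y and z = x and
        L = "\<lambda>x y z. witt_add p x y" and R = "\<lambda>x y z. witt_add p y x"])
     (simp_all add: witt_ghosts witt_simps add.commute)

lemma witt_add_zero: "witt_add p witt_zero x = x"
  by (rule witt_transfer[OF p, where x = x and y = x and z = x and
        L = "\<lambda>x y z. witt_add p witt_zero x" and R = "\<lambda>x y z. x"])
     (simp_all add: witt_ghosts witt_simps)

lemma witt_add_neg: "witt_add p (witt_neg p x) x = witt_zero"
  by (rule witt_transfer[OF p, where x = x and y = x and z = x and
        L = "\<lambda>x y z. witt_add p (witt_neg p x) x" and R = "\<lambda>x y z. witt_zero"])
     (simp_all add: witt_ghosts witt_simps)

lemma witt_mult_assoc: "witt_mult p (witt_mult p x y) z = witt_mult p x (witt_mult p y z)"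
  by (rule witt_transfer[OF p, where x = x and y = y and z = z and
        L = "\<lambda>x y z. witt_mult p (witt_mult p x y) z" and R = "\<lambda>x y z. witt_mult p x (witt_mult p y z)"])
     (simp_all add: witt_ghosts witt_simps mult.assoc)

lemma witt_mult_commute: "witt_mult p x y = witt_mult p y x"
  by (rule witt_transfer[OF p, where x = x and y = y and z = x and
        L = "\<lambda>x y z. witt_mult p x y" and R = "\<lambda>x y z. witt_mult p y x"])
     (simp_all add: witt_ghosts witt_simps mult.commute)

lemma witt_mult_one: "witt_mult p witt_one x = x"
  by (rule witt_transfer[OF p, where x = x and y = x and z = x and
        L = "\<lambda>x y z. witt_mult p witt_one x" and R = "\<lambda>x y z. x"])
     (simp_all add: witt_ghosts witt_simps)

lemma witt_distrib: "witt_mult p (witt_add p x y) z = witt_add p (witt_mult p x z) (witt_mult p y z)"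
  by (rule witt_transfer[OF p, where x = x and y = y and z = z and
        L = "\<lambda>x y z. witt_mult p (witt_add p x y) z" and
        R = "\<lambda>x y z. witt_add p (witt_mult p x z) (witt_mult p y z)"])
     (simp_all add: witt_ghosts witt_simps distrib_right)

end


section \<open>Witt vectors in characteristic p have no zero divisors\<close>

definition seq_shift :: "(nat \<Rightarrow> 'a::zero) \<Rightarrow> nat \<Rightarrow> 'a" where
  "seq_shift x n = (case n of 0 \<Rightarrow> 0 | Suc m \<Rightarrow> x m)"

lemma ghost_seq_shift:
  assumes "p > 0"
  shows "ghost p (seq_shift x) (Suc n) = of_nat p * ghost p x n" "ghost p (seq_shift x) 0 = 0"
proof -
  have "ghost p (seq_shift x) (Suc n) = (\<Sum>i\<le>n. of_nat p ^ Suc i * x i ^ p ^ (n - i))"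
    unfolding ghost_def sum.atMost_Suc_shift using assms by (simp add: seq_shift_def zero_power)
  then show "ghost p (seq_shift x) (Suc n) = of_nat p * ghost p x n"
    by (simp add: ghost_def sum_distrib_left mult.assoc)
qed (simp add: ghost_def seq_shift_def)

lemma ghost_cong_imp_cong:
  fixes x y :: "nat \<Rightarrow> zpoly"
  assumes p: "p > 0" and g: "\<And>n. of_nat p ^ Suc n dvd ghost p x n - ghost p y n"
  shows "of_nat p dvd x n - y n"
proof (induction n rule: less_induct)
  case (less n)
  have "of_nat p ^ Suc n dvd (\<Sum>i<n. of_nat p ^ i * x i ^ (p ^ (n - i)))
      - (\<Sum>i<n. of_nat p ^ i * y i ^ (p ^ (n - i)))" (is "_ dvd ?X - ?Y")
    unfolding sum_subtractf[symmetric]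
  proof (rule dvd_sum)
    fix i assume i: "i \<in> {..<n}"
    then have "of_nat p ^ Suc (n - i) dvd x i ^ (p ^ (n - i)) - y i ^ (p ^ (n - i))"
      by (intro dvd_power_p_power_diff less) simp
    then have "of_nat p ^ i * of_nat p ^ Suc (n - i) dvd
        of_nat p ^ i * (x i ^ (p ^ (n - i)) - y i ^ (p ^ (n - i)))"
      by (rule mult_dvd_mono[OF dvd_refl])
    moreover have "(of_nat p :: zpoly) ^ i * of_nat p ^ Suc (n - i) = of_nat p ^ Suc n"
      using i by (simp flip: power_add power_Suc)
    ultimately show "of_nat p ^ Suc n dvd of_nat p ^ i * x i ^ (p ^ (n - i))
        - of_nat p ^ i * y i ^ (p ^ (n - i))"
      by (simp only: right_diff_distrib)
  qed
  then have "of_nat p ^ Suc n dvd (ghost p x n - ghost p y n) - (?X - ?Y)"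
    using dvd_diff[OF g[of n]] by blast
  moreover have "(ghost p x n - ghost p y n) - (?X - ?Y) = of_nat p ^ n * (x n - y n)"
    by (simp add: ghost_split right_diff_distrib)
  ultimately have "of_nat p ^ Suc n dvd of_nat p ^ n * (x n - y n)"
    by (simp only:)
  then obtain Q where "of_nat p ^ n * (x n - y n) = of_nat p ^ Suc n * Q"
    by (rule dvdE)
  then have "of_nat p ^ n * (x n - y n) = of_nat p ^ n * (of_nat p * Q)"
    by (simp only: power_Suc2 mult.assoc)
  then have "of_int (int p ^ n) * (x n - y n) = of_int (int p ^ n) * (of_nat p * Q)"
    by simp
  then have "x n - y n = of_nat p * Q"
    by (rule zpoly_cancel) (use p in simp)
  then show ?case by simp
qed

lemma witt_mult_seq_shift:
  fixes x y :: "nat \<Rightarrow> 'a::comm_ring_1"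
  assumes p: "prime p" and char: "of_nat p = (0 :: 'a)"
  shows "witt_mult p (seq_shift x) y = seq_shift (witt_mult p x (\<lambda>n. y n ^ p))"
proof
  fix n
  define X where "X = (\<lambda>i. zvar (0, i))"
  define Y where "Y = (\<lambda>i. zvar (Suc 0, i))"
  have p0: "p > 0" using p by (rule prime_gt_0_nat)
  define e where "e = zeval (val3 x y x)"
  have e: "is_ring_hom e" by (simp add: e_def is_ring_hom_zeval)
  have eX: "(\<lambda>i. e (X i)) = x" "(\<lambda>i. e (Y i)) = y"
    by (simp_all add: e_def X_def Y_def zeval_val3)
  have sh: "e (seq_shift w n) = seq_shift (\<lambda>i. e (w i)) n" for w n
    by (simp add: seq_shift_def hom_zero[OF e] split: nat.split)
  have "of_nat p ^ Suc n dvd ghost p (witt_mult p (seq_shift X) Y) n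
      - ghost p (seq_shift (witt_mult p X (\<lambda>n. Y n ^ p))) n" for n
  proof (cases n)
    case 0
    then show ?thesis by (simp add: ghost_witt_mult[OF p] ghost_seq_shift[OF p0])
  next
    case (Suc m)
    have "ghost p (witt_mult p (seq_shift X) Y) n
        = (of_nat p * ghost p X m) * (ghost p (\<lambda>n. Y n ^ p) m + of_nat p ^ n * Y n)"
      by (simp only: Suc ghost_witt_mult[OF p] ghost_seq_shift[OF p0] ghost_Suc[of p Y])
    moreover have "ghost p (seq_shift (witt_mult p X (\<lambda>n. Y n ^ p))) n
        = of_nat p * (ghost p X m * ghost p (\<lambda>n. Y n ^ p) m)"
      by (simp only: Suc ghost_witt_mult[OF p] ghost_seq_shift[OF p0])
    ultimately have "ghost p (witt_mult p (seq_shift X) Y) n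
      - ghost p (seq_shift (witt_mult p X (\<lambda>n. Y n ^ p))) n = of_nat p ^ Suc n * (ghost p X m * Y n)"
      by (simp add: algebra_simps)
    then show ?thesis by simp
  qed
  then have "of_nat p dvd witt_mult p (seq_shift X) Y n - seq_shift (witt_mult p X (\<lambda>n. Y n ^ p)) n"
    by (rule ghost_cong_imp_cong[OF p0])
  then obtain Q where Q: "witt_mult p (seq_shift X) Y n
      - seq_shift (witt_mult p X (\<lambda>n. Y n ^ p)) n = of_nat p * Q"
    by (rule dvdE)
  have "e (witt_mult p (seq_shift X) Y n) - e (seq_shift (witt_mult p X (\<lambda>n. Y n ^ p)) n) = 0"
    unfolding hom_diff[OF e, symmetric] Q by (simp add: hom_mult[OF e] hom_of_nat[OF e] char)
  moreover have "e (witt_mult p (seq_shift X) Y n) = witt_mult p (seq_shift x) y n"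
    using fun_cong[OF witt_mult_hom[OF e, of p "seq_shift X" Y], of n] by (simp add: sh eX)
  moreover have "e (seq_shift (witt_mult p X (\<lambda>n. Y n ^ p)) n)
      = seq_shift (witt_mult p x (\<lambda>n. y n ^ p)) n"
    using fun_cong[OF eX(2)] by (simp add: sh witt_mult_hom[OF e] hom_power[OF e] eX)
  ultimately show "witt_mult p (seq_shift x) y n = seq_shift (witt_mult p x (\<lambda>n. y n ^ p)) n"
    by simp
qed

lemma witt_mult_nth_0:
  assumes "prime p"
  shows "witt_mult p x y 0 = x 0 * y 0"
  using ghost_witt_mult[OF assms, of x y 0] by (simp add: ghost_def)

lemma witt_mult_seq_shift_power:
  fixes x y :: "nat \<Rightarrow> 'a::comm_ring_1"
  assumes p: "prime p" and char: "of_nat p = (0 :: 'a)"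
  shows "witt_mult p ((seq_shift ^^ m) x) y = (seq_shift ^^ m) (witt_mult p x (\<lambda>n. y n ^ (p ^ m)))"
proof (induction m arbitrary: y)
  case (Suc m)
  show ?case
    by (simp add: witt_mult_seq_shift[OF p char] Suc flip: power_mult)
qed simp

lemma seq_shift_power_nth: "(seq_shift ^^ m) x n = (if n < m then 0 else x (n - m))"
  by (induction m arbitrary: n) (auto simp: seq_shift_def split: nat.split)

lemma seq_shift_decompose:
  assumes "x \<noteq> witt_zero"
  obtains m x' where "x = (seq_shift ^^ m) x'" "x' 0 \<noteq> 0"
proof -
  have ex: "\<exists>n. x n \<noteq> 0" using assms by (auto simp: witt_zero_def)
  define m where "m = (LEAST n. x n \<noteq> 0)"
  have "x m \<noteq> 0" unfolding m_def using ex by (rule LeastI_ex)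
  moreover have "x n = 0" if "n < m" for n using not_less_Least[of n] that unfolding m_def by blast
  ultimately show ?thesis
    by (intro that[of m "\<lambda>n. x (n + m)"]) (auto simp: seq_shift_power_nth)
qed

lemma witt_mult_nonzero:
  fixes x y :: "nat \<Rightarrow> 'a::idom"
  assumes p: "prime p" and char: "of_nat p = (0 :: 'a)"
    and "x \<noteq> witt_zero" "y \<noteq> witt_zero"
  shows "witt_mult p x y \<noteq> witt_zero"
proof -
  obtain m x' where x: "x = (seq_shift ^^ m) x'" "x' 0 \<noteq> 0"
    using assms(3) by (rule seq_shift_decompose)
  obtain n y' where y: "y = (seq_shift ^^ n) y'" "y' 0 \<noteq> 0"
    using assms(4) by (rule seq_shift_decompose)
  have pm: "0 < p ^ m" using prime_gt_0_nat[OF p] by simp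
  have y2: "(\<lambda>k. y k ^ (p ^ m)) = (seq_shift ^^ n) (\<lambda>k. y' k ^ (p ^ m))"
    unfolding y using pm by (auto simp: seq_shift_power_nth zero_power)
  have "witt_mult p x y = (seq_shift ^^ m) (witt_mult p x' (\<lambda>k. y k ^ (p ^ m)))"
    unfolding x(1) by (rule witt_mult_seq_shift_power[OF p char])
  also have "\<dots> = (seq_shift ^^ m) (witt_mult p ((seq_shift ^^ n) (\<lambda>k. y' k ^ (p ^ m))) x')"
    unfolding y2 by (simp only: witt_mult_commute[OF p])
  also have "\<dots> = (seq_shift ^^ m) ((seq_shift ^^ n)
      (witt_mult p (\<lambda>k. y' k ^ (p ^ m)) (\<lambda>k. x' k ^ (p ^ n))))"
    by (simp only: witt_mult_seq_shift_power[OF p char])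
  finally have "witt_mult p x y (m + n) = y' 0 ^ (p ^ m) * x' 0 ^ (p ^ n)"
    by (simp add: seq_shift_power_nth witt_mult_nth_0[OF p])
  then have "witt_mult p x y (m + n) \<noteq> 0" using x y by simp
  then show ?thesis by (auto simp: witt_zero_def fun_eq_iff)
qed

section \<open>The ring of Witt vectors, its Frobenius and its fraction field\<close>

text \<open>The prime p is the characteristic of the coefficient field.\<close>

typedef 'a witt = "UNIV :: (nat \<Rightarrow> 'a) set"
  morphisms witt_coord Witt ..

setup_lifting type_definition_witt

instantiation witt :: (field_prime_char) comm_ring_1
begin

lift_definition zero_witt :: "'a witt" is witt_zero .
lift_definition one_witt :: "'a witt" is witt_one .
lift_definition plus_witt :: "'a witt \<Rightarrow> 'a witt \<Rightarrow> 'a witt" is "witt_add CHAR('a)" .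
lift_definition times_witt :: "'a witt \<Rightarrow> 'a witt \<Rightarrow> 'a witt" is "witt_mult CHAR('a)" .
lift_definition uminus_witt :: "'a witt \<Rightarrow> 'a witt" is "witt_neg CHAR('a)" .
definition minus_witt :: "'a witt \<Rightarrow> 'a witt \<Rightarrow> 'a witt" where "minus_witt x y = x + (- y)"

instance
proof
  fix a b c :: "'a witt"
  show "a + b + c = a + (b + c)" by transfer (rule witt_add_assoc[OF CHAR_prime])
  show "a + b = b + a" by transfer (rule witt_add_commute[OF CHAR_prime])
  show "0 + a = a" by transfer (rule witt_add_zero[OF CHAR_prime])
  show "- a + a = 0" by transfer (rule witt_add_neg[OF CHAR_prime])
  show "a - b = a + - b" by (rule minus_witt_def)
  show "a * b * c = a * (b * c)" by transfer (rule witt_mult_assoc[OF CHAR_prime])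
  show "a * b = b * a" by transfer (rule witt_mult_commute[OF CHAR_prime])
  show "1 * a = a" by transfer (rule witt_mult_one[OF CHAR_prime])
  show "(a + b) * c = a * c + b * c" by transfer (rule witt_distrib[OF CHAR_prime])
  show "(0 :: 'a witt) \<noteq> 1" by transfer (auto simp: witt_zero_def witt_one_def fun_eq_iff)
qed

end

instance witt :: (field_prime_char) idom
proof
  fix a b :: "'a witt"
  show "a * b \<noteq> 0" if "a \<noteq> 0" "b \<noteq> 0"
    using that by transfer (rule witt_mult_nonzero[OF CHAR_prime of_nat_CHAR])
qed

lift_definition witt_frob :: "'a::field_prime_char witt \<Rightarrow> 'a witt" is "\<lambda>x n. x n ^ CHAR('a)" .

lemma is_ring_hom_frob: "is_ring_hom (\<lambda>a :: 'a::field_prime_char. a ^ CHAR('a))"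
  by (simp add: is_ring_hom_def freshmans_dream[OF CHAR_prime] power_mult_distrib)

lemma is_ring_hom_witt_frob: "is_ring_hom (witt_frob :: 'a::field_prime_char witt \<Rightarrow> 'a witt)"
  unfolding is_ring_hom_def
  by (intro conjI allI; transfer;
      simp add: witt_add_hom[OF is_ring_hom_frob] witt_mult_hom[OF is_ring_hom_frob]
        witt_one_hom[OF is_ring_hom_frob])

lemma witt_frob_inj: "witt_frob x = witt_frob y \<longleftrightarrow> x = y"
proof -
  have "a = b" if "a ^ CHAR('a) = b ^ CHAR('a)" for a b :: 'a
  proof -
    have "(a - b) ^ CHAR('a) = a ^ CHAR('a) - b ^ CHAR('a)"
      by (rule hom_diff[OF is_ring_hom_frob])
    with that show ?thesis by simp
  qed
  then show ?thesis by transfer (auto simp: fun_eq_iff)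
qed

lemma witt_frob_eq_0_iff: "witt_frob x = 0 \<longleftrightarrow> x = 0"
  using witt_frob_inj[of x 0] by (simp add: hom_zero[OF is_ring_hom_witt_frob])

lemma surj_witt_frob: "surj (witt_frob :: 'k::{alg_closed_field, field_prime_char} witt \<Rightarrow> 'k witt)"
proof (rule surjI[where f = "\<lambda>y. SOME x. witt_frob x = y"])
  fix y :: "'k witt"
  have root: "\<exists>b. b ^ CHAR('k) = a" for a :: 'k
    using nth_root_exists[OF prime_gt_0_nat[OF CHAR_prime[where 'a = 'k]], of a] by blast
  have "witt_frob (Witt (\<lambda>n. SOME b. b ^ CHAR('k) = witt_coord y n)) = y"
    by (rule witt_coord_inject[THEN iffD1])
       (simp add: witt_frob.rep_eq Witt_inverse someI_ex[OF root])
  then have "\<exists>x. witt_frob x = y" ..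
  then show "witt_frob (SOME x. witt_frob x = y) = y" by (rule someI_ex)
qed

text \<open>The extension of the Frobenius of Witt vectors to the fraction field.\<close>

definition fract_frob :: "'a::field_prime_char witt fract \<Rightarrow> 'a witt fract" where
  "fract_frob q = (THE r. \<exists>a b. b \<noteq> 0 \<and> q = Fract a b \<and> r = Fract (witt_frob a) (witt_frob b))"

lemma fract_frob_Fract:
  assumes "b \<noteq> 0"
  shows "fract_frob (Fract a b) = Fract (witt_frob a) (witt_frob b)"
  unfolding fract_frob_def
proof (rule the_equality)
  fix r assume "\<exists>a' b'. b' \<noteq> 0 \<and> Fract a b = Fract a' b' \<and> r = Fract (witt_frob a') (witt_frob b')"
  then obtain a' b' where *: "b' \<noteq> 0" "Fract a b = Fract a' b'" "r = Fract (witt_frob a') (witt_frob b')"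
    by blast
  then have "a * b' = a' * b" using assms by (simp add: eq_fract)
  then have "witt_frob a * witt_frob b' = witt_frob a' * witt_frob b"
    by (simp flip: hom_mult[OF is_ring_hom_witt_frob])
  with * assms show "r = Fract (witt_frob a) (witt_frob b)"
    by (simp add: eq_fract witt_frob_eq_0_iff)
qed (use assms in blast)

section \<open>The Dieudonne ring\<close>

text \<open>The ring generated by W(k), F and V: formal expressions modulo the smallest congruence
  containing the ring axioms, the ring structure of W(k) and the defining relations.\<close>

datatype 'k dexpr =
  Const "'k witt" | Frob | Ver | Plus "'k dexpr" "'k dexpr" | Times "'k dexpr" "'k dexpr" | Neg "'k dexpr"

inductive dexpr_eq :: "'k::{alg_closed_field, field_prime_char} dexpr \<Rightarrow> 'k dexpr \<Rightarrow> bool" where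
  refl: "dexpr_eq a a"
| sym: "dexpr_eq a b \<Longrightarrow> dexpr_eq b a"
| trans: "dexpr_eq a b \<Longrightarrow> dexpr_eq b c \<Longrightarrow> dexpr_eq a c"
| plus: "dexpr_eq a a' \<Longrightarrow> dexpr_eq b b' \<Longrightarrow> dexpr_eq (Plus a b) (Plus a' b')"
| times: "dexpr_eq a a' \<Longrightarrow> dexpr_eq b b' \<Longrightarrow> dexpr_eq (Times a b) (Times a' b')"
| neg: "dexpr_eq a a' \<Longrightarrow> dexpr_eq (Neg a) (Neg a')"
| plus_assoc: "dexpr_eq (Plus (Plus a b) c) (Plus a (Plus b c))"
| plus_commute: "dexpr_eq (Plus a b) (Plus b a)"
| plus_zero: "dexpr_eq (Plus (Const 0) a) a"
| plus_neg: "dexpr_eq (Plus (Neg a) a) (Const 0)"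
| times_assoc: "dexpr_eq (Times (Times a b) c) (Times a (Times b c))"
| one_times: "dexpr_eq (Times (Const 1) a) a"
| times_one: "dexpr_eq (Times a (Const 1)) a"
| distrib_right: "dexpr_eq (Times (Plus a b) c) (Plus (Times a c) (Times b c))"
| distrib_left: "dexpr_eq (Times a (Plus b c)) (Plus (Times a b) (Times a c))"
| const_plus: "dexpr_eq (Const (v + w)) (Plus (Const v) (Const w))"
| const_times: "dexpr_eq (Const (v * w)) (Times (Const v) (Const w))"
| frob_const: "dexpr_eq (Times Frob (Const w)) (Times (Const (witt_frob w)) Frob)"
| const_ver: "dexpr_eq (Times (Const w) Ver) (Times Ver (Const (witt_frob w)))"
| frob_ver: "dexpr_eq (Times Frob Ver) (Const (of_nat CHAR('k)))"
| ver_frob: "dexpr_eq (Times Ver Frob) (Const (of_nat CHAR('k)))"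

text \<open>The action on W(k) itself with F the Frobenius and V = p times its inverse shows that the
  presented ring is non-trivial.\<close>

primrec dexpr_act :: "'k::{alg_closed_field, field_prime_char} dexpr \<Rightarrow> 'k witt \<Rightarrow> 'k witt" where
  "dexpr_act (Const w) x = w * x"
| "dexpr_act Frob x = witt_frob x"
| "dexpr_act Ver x = of_nat CHAR('k) * inv witt_frob x"
| "dexpr_act (Plus a b) x = dexpr_act a x + dexpr_act b x"
| "dexpr_act (Times a b) x = dexpr_act a (dexpr_act b x)"
| "dexpr_act (Neg a) x = - dexpr_act a x"

lemma inj_witt_frob: "inj witt_frob"
  by (simp add: inj_def witt_frob_inj)

lemma witt_frob_inv: "witt_frob (inv witt_frob (x :: 'k::{alg_closed_field, field_prime_char} witt)) = x"
  by (rule surj_f_inv_f[OF surj_witt_frob])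

lemma inv_witt_frob_eq: "witt_frob y = x \<Longrightarrow> inv witt_frob x = y"
  by (rule inv_f_eq[OF inj_witt_frob])

lemma inv_witt_frob_add:
  "inv witt_frob (x + y :: 'k::{alg_closed_field, field_prime_char} witt) = inv witt_frob x + inv witt_frob y"
  by (rule inv_witt_frob_eq) (simp add: hom_add[OF is_ring_hom_witt_frob] witt_frob_inv)

lemma inv_witt_frob_mult:
  "inv witt_frob (x * y :: 'k::{alg_closed_field, field_prime_char} witt) = inv witt_frob x * inv witt_frob y"
  by (rule inv_witt_frob_eq) (simp add: hom_mult[OF is_ring_hom_witt_frob] witt_frob_inv)

lemma dexpr_act_add: "dexpr_act a (x + y) = dexpr_act a x + dexpr_act a y"
  by (induction a arbitrary: x y)
     (simp_all add: hom_add[OF is_ring_hom_witt_frob] inv_witt_frob_add algebra_simps)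

lemma dexpr_eq_act: "dexpr_eq a b \<Longrightarrow> dexpr_act a x = dexpr_act b x"
proof (induction arbitrary: x rule: dexpr_eq.induct)
  case (frob_const w)
  then show ?case by (simp add: hom_mult[OF is_ring_hom_witt_frob])
next
  case (const_ver w)
  then show ?case
    by (simp add: inv_witt_frob_mult inv_f_f[OF inj_witt_frob] mult.left_commute)
next
  case frob_ver
  then show ?case
    by (simp add: hom_mult[OF is_ring_hom_witt_frob] hom_of_nat[OF is_ring_hom_witt_frob] witt_frob_inv)
next
  case ver_frob
  then show ?case by (simp add: inv_f_f[OF inj_witt_frob])
qed (simp_all add: dexpr_act_add algebra_simps)

quotient_type (overloaded) 'k dieudonne_ring = "'k::{alg_closed_field, field_prime_char} dexpr" / dexpr_eq
  by (intro equivpI reflpI sympI transpI) (blast intro: dexpr_eq.refl dexpr_eq.sym dexpr_eq.trans)+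

instantiation dieudonne_ring :: ("{alg_closed_field, field_prime_char}") ring_1
begin

lift_definition zero_dieudonne_ring :: "'a dieudonne_ring" is "Const 0" .
lift_definition one_dieudonne_ring :: "'a dieudonne_ring" is "Const 1" .
lift_definition plus_dieudonne_ring :: "'a dieudonne_ring \<Rightarrow> 'a dieudonne_ring \<Rightarrow> 'a dieudonne_ring"
  is Plus by (rule dexpr_eq.plus)
lift_definition times_dieudonne_ring :: "'a dieudonne_ring \<Rightarrow> 'a dieudonne_ring \<Rightarrow> 'a dieudonne_ring"
  is Times by (rule dexpr_eq.times)
lift_definition uminus_dieudonne_ring :: "'a dieudonne_ring \<Rightarrow> 'a dieudonne_ring"
  is Neg by (rule dexpr_eq.neg)
definition minus_dieudonne_ring :: "'a dieudonne_ring \<Rightarrow> 'a dieudonne_ring \<Rightarrow> 'a dieudonne_ring" where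
  "minus_dieudonne_ring a b = a + (- b)"

instance
proof
  fix a b c :: "'a dieudonne_ring"
  show "a + b + c = a + (b + c)" by transfer (rule dexpr_eq.plus_assoc)
  show "a + b = b + a" by transfer (rule dexpr_eq.plus_commute)
  show "0 + a = a" by transfer (rule dexpr_eq.plus_zero)
  show "- a + a = 0" by transfer (rule dexpr_eq.plus_neg)
  show "a - b = a + - b" by (rule minus_dieudonne_ring_def)
  show "a * b * c = a * (b * c)" by transfer (rule dexpr_eq.times_assoc)
  show "1 * a = a" by transfer (rule dexpr_eq.one_times)
  show "a * 1 = a" by transfer (rule dexpr_eq.times_one)
  show "(a + b) * c = a * c + b * c" by transfer (rule dexpr_eq.distrib_right)
  show "a * (b + c) = a * b + a * c" by transfer (rule dexpr_eq.distrib_left)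
  show "(0 :: 'a dieudonne_ring) \<noteq> 1"
    by transfer (auto dest: dexpr_eq_act[where x = 1])
qed

end

lift_definition D_const :: "'k::{alg_closed_field, field_prime_char} witt \<Rightarrow> 'k dieudonne_ring" is Const .
lift_definition D_F :: "'k::{alg_closed_field, field_prime_char} dieudonne_ring" is Frob .
lift_definition D_V :: "'k::{alg_closed_field, field_prime_char} dieudonne_ring" is Ver .

lemma D_relations:
  fixes w v :: "'k::{alg_closed_field, field_prime_char} witt"
  shows "D_const 0 = (0 :: 'k dieudonne_ring)" "D_const 1 = (1 :: 'k dieudonne_ring)"
    "D_const (v + w) = D_const v + D_const w" "D_const (v * w) = D_const v * D_const w"
    "D_F * D_const w = D_const (witt_frob w) * D_F"
    "D_const w * D_V = D_V * D_const (witt_frob w)"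
    "D_F * D_V = D_const (of_nat CHAR('k) :: 'k witt)" "D_V * D_F = D_const (of_nat CHAR('k) :: 'k witt)"
  subgoal by transfer (rule dexpr_eq.refl)
  subgoal by transfer (rule dexpr_eq.refl)
  subgoal by transfer (rule dexpr_eq.const_plus)
  subgoal by transfer (rule dexpr_eq.const_times)
  subgoal by transfer (rule dexpr_eq.frob_const)
  subgoal by transfer (rule dexpr_eq.const_ver)
  subgoal by transfer (rule dexpr_eq.frob_ver)
  subgoal by transfer (rule dexpr_eq.ver_frob)
  done

lemma dieudonne_ring_induct [case_names const F V add mult uminus]:
  assumes "\<And>w. P (D_const w)" "P D_F" "P D_V"
    "\<And>a b. P a \<Longrightarrow> P b \<Longrightarrow> P (a + b)" "\<And>a b. P a \<Longrightarrow> P b \<Longrightarrow> P (a * b)" "\<And>a. P a \<Longrightarrow> P (- a)"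
  shows "P (d :: 'k::{alg_closed_field, field_prime_char} dieudonne_ring)"
proof (induction d rule: dieudonne_ring.abs_induct)
  case (1 e)
  show ?case
    by (induction e)
       (use assms in \<open>simp_all flip: D_const.abs_eq D_F_def D_V_def plus_dieudonne_ring.abs_eq
         times_dieudonne_ring.abs_eq uminus_dieudonne_ring.abs_eq\<close>)
qed

section \<open>The superspecial module\<close>

text \<open>The left module obtained from the Dieudonne ring D by dividing out the left ideal D (F - V).\<close>

definition A11_rel :: "'k::{alg_closed_field, field_prime_char} dieudonne_ring \<Rightarrow> 'k dieudonne_ring \<Rightarrow> bool" where
  "A11_rel a b \<longleftrightarrow> (\<exists>d. a - b = d * (D_F - D_V))"

lemma A11_rel_add: "A11_rel a b \<Longrightarrow> A11_rel c d \<Longrightarrow> A11_rel (a + c) (b + d)"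
proof -
  assume "A11_rel a b" "A11_rel c d"
  then obtain e f where "a - b = e * (D_F - D_V)" "c - d = f * (D_F - D_V)"
    by (auto simp: A11_rel_def)
  then have "(a + c) - (b + d) = (e + f) * (D_F - D_V)"
    by (simp add: add_diff_add ring_distribs)
  then show ?thesis unfolding A11_rel_def ..
qed

lemma A11_rel_mult: "A11_rel a b \<Longrightarrow> A11_rel (c * a) (c * b)"
proof -
  assume "A11_rel a b"
  then obtain e where "a - b = e * (D_F - D_V)"
    by (auto simp: A11_rel_def)
  then have "c * a - c * b = (c * e) * (D_F - D_V)"
    by (simp only: mult.assoc flip: right_diff_distrib)
  then show ?thesis unfolding A11_rel_def ..
qed

lemma A11_rel_uminus: "A11_rel a b \<Longrightarrow> A11_rel (- a) (- b)"
  using A11_rel_mult[of a b "- 1"] by simp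

lemma A11_rel_equivp: "equivp (A11_rel :: 'k::{alg_closed_field, field_prime_char} dieudonne_ring \<Rightarrow> _)"
proof (intro equivpI reflpI sympI transpI)
  show refl: "A11_rel a a" for a :: "'k dieudonne_ring"
    unfolding A11_rel_def by (rule exI[of _ 0]) simp
  fix a b c :: "'k dieudonne_ring"
  show "A11_rel b a" if "A11_rel a b"
    using A11_rel_add[OF A11_rel_uminus[OF that] refl[of "a + b"]] by simp
  show "A11_rel a c" if "A11_rel a b" "A11_rel b c"
    using A11_rel_add[OF A11_rel_add[OF that] refl[of "- b"]] by simp
qed

quotient_type (overloaded) 'k A11 = "'k::{alg_closed_field, field_prime_char} dieudonne_ring" / A11_rel
  by (rule A11_rel_equivp)

instantiation A11 :: ("{alg_closed_field, field_prime_char}") ab_group_add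
begin

lift_definition zero_A11 :: "'a A11" is 0 .
lift_definition plus_A11 :: "'a A11 \<Rightarrow> 'a A11 \<Rightarrow> 'a A11" is "(+)" by (rule A11_rel_add)
lift_definition uminus_A11 :: "'a A11 \<Rightarrow> 'a A11" is uminus by (rule A11_rel_uminus)
definition minus_A11 :: "'a A11 \<Rightarrow> 'a A11 \<Rightarrow> 'a A11" where "minus_A11 a b = a + (- b)"

instance
proof
  fix a b c :: "'a A11"
  show "a + b + c = a + (b + c)"
    by transfer (simp add: add.assoc equivp_reflp[OF A11_rel_equivp])
  show "a + b = b + a"
    by transfer (simp add: add.commute equivp_reflp[OF A11_rel_equivp])
  show "0 + a = a" by transfer (simp add: equivp_reflp[OF A11_rel_equivp])
  show "- a + a = 0" by transfer (simp add: equivp_reflp[OF A11_rel_equivp])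
  show "a - b = a + - b" by (rule minus_A11_def)
qed

end

lifting_forget dieudonne_ring.lifting

lift_definition A11_act :: "'k::{alg_closed_field, field_prime_char} dieudonne_ring \<Rightarrow> 'k A11 \<Rightarrow> 'k A11"
  is "(*)" by (rule A11_rel_mult)

text \<open>The direct sum of g copies of A11, as sequences vanishing from index g on.\<close>

definition A11_power :: "nat \<Rightarrow> (nat \<Rightarrow> 'k::{alg_closed_field, field_prime_char} A11) set" where
  "A11_power g = {v. \<forall>j\<ge>g. v j = 0}"

section \<open>Dieudonne modules as lattices\<close>

locale left_module =
  fixes act :: "'r::ring_1 \<Rightarrow> 'm::ab_group_add \<Rightarrow> 'm"
  assumes act_add_right: "act r (x + y) = act r x + act r y"
    and act_add_left: "act (r + s) x = act r x + act s x"
    and act_mult: "act (r * s) x = act r (act s x)"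
    and act_one: "act 1 x = x"

text \<open>All modules of a chain are commensurable, so they live in one ambient space N, a vector
  space over K = Frac W(k) with a compatible action of the Dieudonne ring. For a submodule M of N
  that is generated over W(k) by a K-basis of N, the space N is the tensor product of M with K.\<close>

locale rational_dieudonne_module = left_module act + vector_space scale
  for act :: "'k::{alg_closed_field, field_prime_char} dieudonne_ring \<Rightarrow> 'n::ab_group_add \<Rightarrow> 'n"
    and scale :: "'k witt fract \<Rightarrow> 'n \<Rightarrow> 'n" +
  assumes act_const: "act (D_const w) x = scale (to_fract w) x"

definition dieudonne_module ::
  "('k::{alg_closed_field, field_prime_char} dieudonne_ring \<Rightarrow> 'n::ab_group_add \<Rightarrow> 'n) \<Rightarrow>
   ('k witt fract \<Rightarrow> 'n \<Rightarrow> 'n) \<Rightarrow> nat \<Rightarrow> 'n set \<Rightarrow> bool" where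
  "dieudonne_module act scale g M \<longleftrightarrow>
     (\<forall>d. \<forall>x\<in>M. act d x \<in> M) \<and>
     (\<exists>B. finite B \<and> card B = 2 * g \<and> \<not> module.dependent scale B \<and> module.span scale B = UNIV \<and>
        M = module.span (\<lambda>w. act (D_const w)) B)"

definition isomorphic_A11_power ::
  "('k::{alg_closed_field, field_prime_char} dieudonne_ring \<Rightarrow> 'n::ab_group_add \<Rightarrow> 'n) \<Rightarrow>
   nat \<Rightarrow> 'n set \<Rightarrow> bool" where
  "isomorphic_A11_power act g M \<longleftrightarrow>
     (\<exists>\<phi>. bij_betw \<phi> M (A11_power g) \<and>
        (\<forall>x\<in>M. \<forall>y\<in>M. \<phi> (x + y) = (\<lambda>j. \<phi> x j + \<phi> y j)) \<and>
        (\<forall>d. \<forall>x\<in>M. \<phi> (act d x) = (\<lambda>j. A11_act d (\<phi> x j))))"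

text \<open>Supersingular of genus g means isogenous to the g-th power of A11. The image of an isogeny
  from this power to M is a submodule of M of the same rank, i.e. again a lattice in N.\<close>

definition supersingular ::
  "('k::{alg_closed_field, field_prime_char} dieudonne_ring \<Rightarrow> 'n::ab_group_add \<Rightarrow> 'n) \<Rightarrow>
   ('k witt fract \<Rightarrow> 'n \<Rightarrow> 'n) \<Rightarrow> nat \<Rightarrow> 'n set \<Rightarrow> bool" where
  "supersingular act scale g M \<longleftrightarrow>
     (\<exists>L. L \<subseteq> M \<and> dieudonne_module act scale g L \<and> isomorphic_A11_power act g L)"

text \<open>A W(k)-bilinear form on a lattice with values in K extends uniquely to a K-bilinear form on N;
  forms are given by this extension.\<close>

definition K_bilinear :: "('a::field \<Rightarrow> 'n::ab_group_add \<Rightarrow> 'n) \<Rightarrow> ('n \<Rightarrow> 'n \<Rightarrow> 'a) \<Rightarrow> bool" where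
  "K_bilinear scale form \<longleftrightarrow>
     (\<forall>x. Vector_Spaces.linear scale (*) (form x)) \<and>
     (\<forall>y. Vector_Spaces.linear scale (*) (\<lambda>x. form x y))"

definition quasi_polarised ::
  "('k::{alg_closed_field, field_prime_char} dieudonne_ring \<Rightarrow> 'n::ab_group_add \<Rightarrow> 'n) \<Rightarrow>
   ('k witt fract \<Rightarrow> 'n \<Rightarrow> 'n) \<Rightarrow> ('n \<Rightarrow> 'n \<Rightarrow> 'k witt fract) \<Rightarrow> 'n set \<Rightarrow> bool" where
  "quasi_polarised act scale form M \<longleftrightarrow>
     K_bilinear scale form \<and>
     (\<forall>x\<in>M. form x x = 0) \<and>
     (\<forall>x\<in>M. (\<forall>y\<in>M. form x y = 0) \<longrightarrow> x = 0) \<and>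
     (\<forall>x\<in>M. \<forall>y\<in>M. form (act D_F x) y = fract_frob (form x (act D_V y)))"

text \<open>The set \<open>range to_fract\<close> is W(k) inside K.\<close>

definition dual_module ::
  "('n \<Rightarrow> 'n \<Rightarrow> 'k::field_prime_char witt fract) \<Rightarrow> 'n set \<Rightarrow> 'n set" where
  "dual_module form M = {x. \<forall>y\<in>M. form x y \<in> range to_fract}"

text \<open>M / M' is a k-vector space of dimension d. Here k = W(k) / p W(k) via the residue map sending a
  Witt vector to its zeroth coordinate, and coefficients in k are represented by Witt vectors.\<close>

definition quotient_has_dim ::
  "('k::{alg_closed_field, field_prime_char} dieudonne_ring \<Rightarrow> 'n::ab_group_add \<Rightarrow> 'n) \<Rightarrow>
   'n set \<Rightarrow> 'n set \<Rightarrow> nat \<Rightarrow> bool" where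
  "quotient_has_dim act M M' d \<longleftrightarrow>
     M' \<subseteq> M \<and> (\<forall>x\<in>M. act (of_nat CHAR('k)) x \<in> M') \<and>
     (\<exists>B. B \<subseteq> M \<and> finite B \<and> card B = d \<and>
        (\<forall>x\<in>M. \<exists>c. x - (\<Sum>b\<in>B. act (D_const (c b)) b) \<in> M') \<and>
        (\<forall>c. (\<Sum>b\<in>B. act (D_const (c b)) b) \<in> M' \<longrightarrow> (\<forall>b\<in>B. witt_coord (c b) 0 = 0)))"

text \<open>The W(k)-submodule generated by F M and V M.\<close>

definition FV_image ::
  "('k::{alg_closed_field, field_prime_char} dieudonne_ring \<Rightarrow> 'n::ab_group_add \<Rightarrow> 'n) \<Rightarrow>
   'n set \<Rightarrow> 'n set" where
  "FV_image act M = module.span (\<lambda>w. act (D_const w)) (act D_F ` M \<union> act D_V ` M)"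

definition descent ::
  "('k::{alg_closed_field, field_prime_char} dieudonne_ring \<Rightarrow> 'n::ab_group_add \<Rightarrow> 'n) \<Rightarrow>
   ('n \<Rightarrow> 'n \<Rightarrow> 'k witt fract) \<Rightarrow> nat \<Rightarrow> 'n set \<Rightarrow> bool" where
  "descent act form l M \<longleftrightarrow>
     (\<forall>j\<le>l div 2. act (D_F ^ (l - j) * D_V ^ j) ` M \<subseteq> dual_module form M)"

end

theory Submission
  imports Defs
begin

text \<open>Up to Frobenius twists and signs, F and V are adjoint for the quasi-polarisation. Hence
  \<open>form (F\<^sup>a V\<^sup>b x) y\<close> lies in W(k) if and only if \<open>form (F\<^sup>b V\<^sup>a y) x\<close> does, the Frobenius being
  an automorphism of Frac(W(k)) that preserves W(k) in both directions
  (\<open>fract_frob_integral_iff\<close>, \<open>pairing_FV_integral_iff\<close>). Two consequences carry the proof. The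
  descent condition, stated for \<open>j \<le> l div 2\<close>, gives integrality of \<open>form (F\<^sup>a V\<^sup>b x) y\<close> for all
  \<open>a + b = l\<close> (\<open>descent_integral\<close>). Moreover, for fixed a and b this
  integrality needs to be tested only on generators of a module (\<open>pairing_FV_integral_span\<close>).

  The generators of \<open>M i\<close> are w and the elements of \<open>F M (i + 1)\<close> and \<open>V M (i + 1)\<close>. If one of the
  two arguments has the form F m or V m, that operator can be absorbed into \<open>F\<^sup>a V\<^sup>b\<close>, which raises
  \<open>a + b = i\<close> to \<open>i + 1\<close>, and the pairing is integral by the descent condition for \<open>M (i + 1)\<close>. What
  remains is the pairing of w with \<open>F\<^sup>a V\<^sup>b w\<close>, integral by hypothesis.\<close>

text \<open>For the implication from left to right, cancel the Frobenius in \<open>\<sigma> c = b * \<sigma> d\<close>: over a perfect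
  field it is bijective on Witt vectors, so b is itself of the form \<open>\<sigma> a\<close>.\<close>

lemma fract_frob_integral_iff:
  fixes q :: "'k::{alg_closed_field, field_prime_char} witt fract"
  shows "fract_frob q \<in> range to_fract \<longleftrightarrow> q \<in> range to_fract"
proof -
  obtain c d where q: "q = Fract c d" "d \<noteq> 0"
    by (cases q) auto
  have frob: "fract_frob q = Fract (witt_frob c) (witt_frob d)" "witt_frob d \<noteq> 0"
    using q by (simp_all add: fract_frob_Fract witt_frob_eq_0_iff)
  have "fract_frob q \<in> range to_fract \<longleftrightarrow> (\<exists>b. witt_frob c = b * witt_frob d)"
    using frob by (auto simp: to_fract_def eq_fract)
  also have "\<dots> \<longleftrightarrow> (\<exists>a. witt_frob c = witt_frob a * witt_frob d)"
    using surj_witt_frob by (metis surjD)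
  also have "\<dots> \<longleftrightarrow> (\<exists>a. c = a * d)"
    by (simp add: witt_frob_inj flip: hom_mult[OF is_ring_hom_witt_frob])
  also have "\<dots> \<longleftrightarrow> q \<in> range to_fract"
    using q by (auto simp: to_fract_def eq_fract)
  finally show ?thesis .
qed

lemma minus_integral_iff: "- q \<in> range to_fract \<longleftrightarrow> q \<in> range to_fract"
  by (metis (no_types, lifting) imageE minus_minus rangeI to_fract_uminus)

lemma (in rational_dieudonne_module) module_D_const: "module (\<lambda>c. act (D_const c))"
  by unfold_locales
    (simp_all add: act_add_right act_add_left act_mult act_one D_relations)

locale polarised_dieudonne_module = rational_dieudonne_module act scale
  for act :: "'k::{alg_closed_field, field_prime_char} dieudonne_ring \<Rightarrow> 'n::ab_group_add \<Rightarrow> 'n"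
    and scale :: "'k witt fract \<Rightarrow> 'n \<Rightarrow> 'n" +
  fixes form :: "'n \<Rightarrow> 'n \<Rightarrow> 'k witt fract" and g :: nat and M :: "'n set"
  assumes lattice: "dieudonne_module act scale g M"
    and polarised: "quasi_polarised act scale form M"
begin

abbreviation FV :: "nat \<Rightarrow> nat \<Rightarrow> 'n \<Rightarrow> 'n" where
  "FV a b \<equiv> act (D_F ^ a * D_V ^ b)"

lemma act_closed: "x \<in> M \<Longrightarrow> act d x \<in> M"
  using lattice by (simp add: dieudonne_module_def)

lemma subspace_lattice: "module.subspace (\<lambda>c. act (D_const c)) M"
  using lattice module.subspace_span[OF module_D_const] by (auto simp: dieudonne_module_def)

lemma form_linear_right: "Vector_Spaces.linear scale (*) (form x)"
  and form_linear_left: "Vector_Spaces.linear scale (*) (\<lambda>x. form x y)"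
  using polarised by (simp_all add: quasi_polarised_def K_bilinear_def)

lemmas form_hom_right = form_linear_right[unfolded Vector_Spaces.linear_def, THEN conjunct2, THEN conjunct2]
lemmas form_hom_left = form_linear_left[unfolded Vector_Spaces.linear_def, THEN conjunct2, THEN conjunct2]

lemma form_add_right: "form x (y + z) = form x y + form x z"
  using form_hom_right by (rule module_hom.add)

lemma form_add_left: "form (x + y) z = form x z + form y z"
  using form_hom_left by (rule module_hom.add)

lemma form_antisym:
  assumes "x \<in> M" "y \<in> M"
  shows "form y x = - form x y"
proof -
  have "x + y \<in> M"
    using assms subspace_lattice module.subspace_add[OF module_D_const] by blast
  then have "form (x + y) (x + y) = 0" "form x x = 0" "form y y = 0"
    using assms polarised by (simp_all add: quasi_polarised_def)
  then show ?thesis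
    by (simp add: form_add_left form_add_right eq_neg_iff_add_eq_0 add.commute)
qed

lemma pairing_commute_integral_iff:
  "x \<in> M \<Longrightarrow> y \<in> M \<Longrightarrow> form x y \<in> range to_fract \<longleftrightarrow> form y x \<in> range to_fract"
  by (simp add: form_antisym[of x y] minus_integral_iff)

lemma pairing_F_integral_iff:
  "x \<in> M \<Longrightarrow> y \<in> M \<Longrightarrow>
    form (act D_F x) y \<in> range to_fract \<longleftrightarrow> form x (act D_V y) \<in> range to_fract"
  using polarised by (simp add: quasi_polarised_def fract_frob_integral_iff)

lemma pairing_V_integral_iff:
  "x \<in> M \<Longrightarrow> y \<in> M \<Longrightarrow>
    form (act D_V x) y \<in> range to_fract \<longleftrightarrow> form x (act D_F y) \<in> range to_fract"
  using pairing_F_integral_iff[of y x]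
  by (simp add: act_closed pairing_commute_integral_iff)

lemma pairing_F_power_integral_iff:
  "x \<in> M \<Longrightarrow> y \<in> M \<Longrightarrow>
    form (act (D_F ^ n) x) y \<in> range to_fract \<longleftrightarrow> form x (act (D_V ^ n) y) \<in> range to_fract"
proof (induction n arbitrary: y)
  case (Suc n)
  have "act (D_V ^ Suc n) y = act (D_V ^ n) (act D_V y)"
    by (simp only: power_Suc2 act_mult)
  then show ?case
    using Suc by (simp add: act_mult act_closed pairing_F_integral_iff)
qed (simp add: act_one)

lemma pairing_V_power_integral_iff:
  "x \<in> M \<Longrightarrow> y \<in> M \<Longrightarrow>
    form (act (D_V ^ n) x) y \<in> range to_fract \<longleftrightarrow> form x (act (D_F ^ n) y) \<in> range to_fract"
  using pairing_F_power_integral_iff[of y x n]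
  by (simp add: act_closed pairing_commute_integral_iff)

lemma D_FV_commute: "(D_V :: 'k dieudonne_ring) ^ b * D_F ^ a = D_F ^ a * D_V ^ b"
proof -
  have "(D_V :: 'k dieudonne_ring) * D_F = D_F * D_V"
    by (simp add: D_relations)
  then show ?thesis
    by (metis power_commuting_commutes)
qed

text \<open>Moving every F and V to the other argument turns them into V and F; antisymmetry then
  exchanges the two arguments.\<close>

lemma pairing_FV_integral_iff:
  assumes "x \<in> M" "y \<in> M"
  shows "form (FV a b x) y \<in> range to_fract \<longleftrightarrow> form (FV b a y) x \<in> range to_fract"
proof -
  have "form (FV a b x) y \<in> range to_fract \<longleftrightarrow>
      form x (act (D_F ^ b) (act (D_V ^ a) y)) \<in> range to_fract"
    using assms
    by (simp add: act_mult act_closed pairing_F_power_integral_iff pairing_V_power_integral_iff)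
  also have "\<dots> \<longleftrightarrow> form (FV b a y) x \<in> range to_fract"
    using assms by (simp add: act_closed pairing_commute_integral_iff flip: act_mult)
  finally show ?thesis .
qed

lemma FV_act_F: "FV a b (act D_F m) = FV (Suc a) b m"
proof -
  have "D_F ^ a * D_V ^ b * D_F = (D_F ^ Suc a * D_V ^ b :: 'k dieudonne_ring)"
    using D_FV_commute[of b 1] by (simp only: power_Suc2 mult.assoc power_one_right)
  then show ?thesis by (simp flip: act_mult)
qed

lemma FV_act_V: "FV a b (act D_V m) = FV a (Suc b) m"
  by (simp add: mult.assoc power_commutes flip: act_mult)

text \<open>Of a and b, one is at most \<open>l div 2\<close>. If it is the exponent of F, exchange the arguments.\<close>

lemma descent_integral:
  assumes "descent act form l M" "a + b = l" "x \<in> M" "y \<in> M"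
  shows "form (FV a b x) y \<in> range to_fract"
proof -
  have low: "form (FV a b x) y \<in> range to_fract"
    if "b \<le> l div 2" "a + b = l" "x \<in> M" "y \<in> M" for a b x y
  proof -
    have "a = l - b" using that by simp
    then show ?thesis
      using assms(1) that by (auto simp: descent_def dual_module_def image_subset_iff)
  qed
  show ?thesis
  proof (cases "b \<le> l div 2")
    case True
    then show ?thesis using assms low by blast
  next
    case False
    then have "a \<le> l div 2" "b + a = l" using assms(2) by simp_all
    then show ?thesis
      using assms low pairing_FV_integral_iff by blast
  qed
qed

lemma subspace_integral_right:
  "module.subspace (\<lambda>c. act (D_const c)) {y. form x y \<in> range to_fract}"
proof -
  have "form x (act (D_const c) y) = to_fract c * form x y" for c y
    unfolding act_const using form_hom_right by (rule module_hom.scale)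
  moreover have "form x 0 = 0"
    using form_hom_right by (rule module_hom.zero)
  ultimately show ?thesis
    unfolding module.subspace_def[OF module_D_const]
    by (auto simp: form_add_right simp flip: to_fract_add to_fract_mult
        intro: range_eqI[of _ _ 0])
qed

text \<open>As F and V are only semilinear, \<open>form (F\<^sup>a V\<^sup>b x) y\<close> is linear in y but not in x. For x, exchange
  the two arguments first.\<close>

lemma pairing_FV_integral_span:
  assumes "S \<subseteq> M"
    and gen: "\<And>x y. x \<in> S \<Longrightarrow> y \<in> S \<Longrightarrow> form (FV a b x) y \<in> range to_fract"
    and x: "x \<in> module.span (\<lambda>c. act (D_const c)) S"
    and y: "y \<in> module.span (\<lambda>c. act (D_const c)) S"
  shows "form (FV a b x) y \<in> range to_fract"
proof -
  have extend: "form u z \<in> range to_fract"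
    if "\<And>s. s \<in> S \<Longrightarrow> form u s \<in> range to_fract"
      "z \<in> module.span (\<lambda>c. act (D_const c)) S" for u z
    using module.span_minimal[OF module_D_const _ subspace_integral_right, of S u] that by blast
  have span_M: "module.span (\<lambda>c. act (D_const c)) S \<subseteq> M"
    using assms(1) subspace_lattice by (rule module.span_minimal[OF module_D_const])
  have "form (FV a b x) s \<in> range to_fract" if s: "s \<in> S" for s
  proof -
    have "form (FV b a s) x \<in> range to_fract"
    proof (rule extend[OF _ x])
      fix t assume "t \<in> S"
      with gen s assms(1) show "form (FV b a s) t \<in> range to_fract"
        using pairing_FV_integral_iff by blast
    qed
    then show ?thesis
      using pairing_FV_integral_iff s x assms(1) span_M by blast
  qed
  then show ?thesis using y by (rule extend)
qed

end

theorem lemma4p3: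
  fixes act :: "'k::{alg_closed_field, field_prime_char} dieudonne_ring \<Rightarrow> 'n::ab_group_add \<Rightarrow> 'n"
    and scale :: "'k witt fract \<Rightarrow> 'n \<Rightarrow> 'n"
    and form :: "'n \<Rightarrow> 'n \<Rightarrow> 'k witt fract"
    and M :: "nat \<Rightarrow> 'n set"
    and g i :: nat
    and w :: 'n
  assumes ambient: "rational_dieudonne_module act scale"
    and range: "i + 2 \<le> g"
    and modules: "\<And>l. i \<le> l \<Longrightarrow> l \<le> g - 1 \<Longrightarrow>
      dieudonne_module act scale g (M l) \<and> supersingular act scale g (M l) \<and>
      quasi_polarised act scale form (M l)"
    and chain: "\<And>l. i < l \<Longrightarrow> l \<le> g - 1 \<Longrightarrow>
      M (l - 1) \<subseteq> M l \<and> FV_image act (M l) \<subseteq> M (l - 1) \<and>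
      quotient_has_dim act (M l) (M (l - 1)) l"
    and top_iso: "isomorphic_A11_power act g (M (g - 1))"
    and top_dual: "dual_module form (M (g - 1)) = act (D_F ^ (g - 1)) ` M (g - 1)"
    and w: "w \<in> M (i + 1)"
    and generated: "M i = module.span (\<lambda>c. act (D_const c))
      ({w} \<union> act D_F ` M (i + 1) \<union> act D_V ` M (i + 1))"
    and descent_above: "\<And>l. i < l \<Longrightarrow> l \<le> g - 1 \<Longrightarrow> descent act form l (M l)"
    and integral: "\<And>j. j \<le> i div 2 \<Longrightarrow>
      form w (act (D_F ^ (i - j) * D_V ^ j) w) \<in> range to_fract"
  shows "descent act form i (M i)"
proof -
  let ?S = "{w} \<union> act D_F ` M (i + 1) \<union> act D_V ` M (i + 1)"
  have le: "i + 1 \<le> g - 1" using range by simp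
  interpret rational_dieudonne_module act scale by (rule ambient)
  interpret polarised_dieudonne_module act scale form g "M (i + 1)"
    by unfold_locales (use modules[of "i + 1"] le in simp_all)
  have above: "form (FV a b x) y \<in> range to_fract"
    if "a + b = i + 1" "x \<in> M (i + 1)" "y \<in> M (i + 1)" for a b x y
    using descent_integral[OF descent_above[of "i + 1"]] le that by simp
  have S: "?S \<subseteq> M (i + 1)"
    using w act_closed by blast
  \<comment> \<open>An element of F M or V M absorbs one operator, so that \<open>a + b\<close> rises from i to \<open>i + 1\<close>.\<close>
  have FV_left: "form (FV a b x) y \<in> range to_fract"
    if "a + b = i" "x \<in> act D_F ` M (i + 1) \<union> act D_V ` M (i + 1)" "y \<in> M (i + 1)" for a b x y
    using that above[of "Suc a" b] above[of a "Suc b"] by (auto simp: FV_act_F FV_act_V)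
  have "form (FV (i - j) j x) y \<in> range to_fract"
    if j: "j \<le> i div 2" and x: "x \<in> M i" and y: "y \<in> M i" for j x y
  proof -
    have sum: "(i - j) + j = i" using j by simp
    have "form (FV (i - j) j s) t \<in> range to_fract" if st: "s \<in> ?S" "t \<in> ?S" for s t
    proof (cases "s = w \<and> t = w")
      case True
      then show ?thesis
        using iffD1[OF pairing_commute_integral_iff[OF w act_closed[OF w]] integral[OF j]]
        by (simp only:)
    next
      case False
      then consider "s \<in> act D_F ` M (i + 1) \<union> act D_V ` M (i + 1)"
        | "t \<in> act D_F ` M (i + 1) \<union> act D_V ` M (i + 1)"
        using st by blast
      then show ?thesis
      proof cases
        case 1
        from sum this subsetD[OF S st(2)] show ?thesis by (rule FV_left)
      next
        case 2
        from sum have "j + (i - j) = i" by (simp only: add.commute)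
        from this 2 subsetD[OF S st(1)] have "form (FV j (i - j) t) s \<in> range to_fract"
          by (rule FV_left)
        then show ?thesis
          using pairing_FV_integral_iff[OF subsetD[OF S st(1)] subsetD[OF S st(2)]] by (simp only:)
      qed
    qed
    from S this x[unfolded generated] y[unfolded generated] show ?thesis
      by (rule pairing_FV_integral_span)
  qed
  then show ?thesis
    by (auto simp: descent_def dual_module_def)
qed

end
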